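(* There are infinitely many points $y\in\mathbb{R}$ for which there is some $s\in\mathbb{N}$ with $\xi(y-s)=\xi(y+s)$. In particular, there are infinitely many points $y$ at which $\xi$ oscillates with period $s$ for some $s\in\mathbb{N}$ (where $s$ may depend on $y$).
   Context: For an integer $n\ge 1$ put $\iota(n)=(-1)^{\pi(n)}$, where $\pi(n)$ is the number of primes $\le n$. For real $x\ge 1$ put $\xi(x)=\sum_{n\le x}\iota(n)$, the sum running over integers $1\le n\le x$; equalities involving $\xi$ are understood with all arguments $\ge 1$. $\mathbb{N}$ denotes the positive integers. For real $y\ge 2$, one says that $\xi$ oscillates at $y$ with period $M$ (and that $y$ is a point of oscillation of $\xi$ with period $M$) if there exist positive real numbers $r$ with $\xi(y-r)=\xi(y+r)$ and $M$ is the minimum of all such $r$. *)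

theory Defs
  imports Complex_Main "HOL-Computational_Algebra.Primes"
begin

definition prime_count :: "nat \<Rightarrow> nat" where
  "prime_count n = card {p. prime p \<and> p \<le> n}"

definition iota :: "nat \<Rightarrow> int" where
  "iota n = (-1) ^ prime_count n"

(* Only meaningful for x >= 1. The sum is empty for x < 1, so every equation between
   values of xi below carries the condition that the smaller argument is >= 1. *)
definition xi :: "real \<Rightarrow> int" where
  "xi x = (\<Sum>n \<in> {n::nat. 1 \<le> n \<and> real n \<le> x}. iota n)"

definition balanced_radii :: "real \<Rightarrow> real set" where
  "balanced_radii y = {r. 0 < r \<and> 1 \<le> y - r \<and> xi (y - r) = xi (y + r)}"

(* M is an attained minimum over all real radii, not an infimum. *)
definition oscillates_at :: "real \<Rightarrow> real \<Rightarrow> bool" where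
  "oscillates_at y M \<longleftrightarrow>
     2 \<le> y \<and> M \<in> balanced_radii y \<and> (\<forall>r \<in> balanced_radii y. M \<le> r)"

end

(* If p is an odd prime, then iota (p - 1) and iota p cancel, so xi is balanced around p - 1
   at radius 1; a radius below 1 leaves only the nonzero summand iota (p - 1) in between. Hence
   xi oscillates with period 1 at every p - 1. *)
theory Submission
  imports Defs
begin

text \<open>Since \<open>xi\<close> is constant on each interval [n, n+1), every value at a real
  argument reduces to a sum over an initial segment of the naturals.\<close>

lemma xi_eq_sum_iota:
  assumes "real n \<le> x" "x < real n + 1"
  shows "xi x = sum iota {1..n}"
proof -
  have "{k::nat. 1 \<le> k \<and> real k \<le> x} = {1..n}"
  proof (intro set_eqI iffI)
    fix k assume "k \<in> {k::nat. 1 \<le> k \<and> real k \<le> x}"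
    then have "1 \<le> k" "real k < real (Suc n)"
      using assms by auto
    then show "k \<in> {1..n}"
      by (simp only: of_nat_less_iff) simp
  next
    fix k assume "k \<in> {1..n}"
    then have "1 \<le> k" "real k \<le> real n"
      by auto
    then show "k \<in> {k::nat. 1 \<le> k \<and> real k \<le> x}"
      using assms by simp
  qed
  then show ?thesis
    by (simp add: xi_def)
qed

lemma prime_count_Suc_prime:
  assumes "prime (Suc n)"
  shows "prime_count (Suc n) = Suc (prime_count n)"
proof -
  have "{p. prime p \<and> p \<le> Suc n} = insert (Suc n) {p. prime p \<and> p \<le> n}"
    using assms by (auto simp: le_Suc_eq)
  then show ?thesis
    by (simp add: prime_count_def)
qed

lemma iota_Suc_prime: "prime (Suc n) \<Longrightarrow> iota (Suc n) = - iota n"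
  by (simp add: iota_def prime_count_Suc_prime)

lemma oscillates_at_before_prime:
  assumes "prime (Suc n)" "2 \<le> n"
  shows "oscillates_at (real n) 1"
proof -
  obtain m where n: "n = Suc m" "1 \<le> m"
    using assms(2) by (cases n) auto
  \<comment> \<open>The endpoint \<open>r = 1\<close> is included: n - r stays in [m, n), so this
    serves both the balance at radius 1 and the exclusion of smaller radii.\<close>
  have below: "xi (real n - r) = sum iota {1..m}" if "0 < r" "r \<le> 1" for r
    using that n by (intro xi_eq_sum_iota) auto
  have "xi (real n + 1) = sum iota {1..Suc n}"
    by (intro xi_eq_sum_iota) auto
  also have "\<dots> = sum iota {1..m}"
    using n iota_Suc_prime[OF assms(1)] by simp
  finally have "1 \<in> balanced_radii (real n)"
    using below[of 1] n by (simp add: balanced_radii_def)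
  moreover have "1 \<le> r" if r: "r \<in> balanced_radii (real n)" for r
  proof (rule ccontr)
    assume "\<not> 1 \<le> r"
    with r have "0 < r" "r < 1" and eq: "xi (real n - r) = xi (real n + r)"
      by (auto simp: balanced_radii_def)
    \<comment> \<open>As n + r is still below n + 1, the cancelling summand
      \<open>iota (Suc n)\<close> has not entered yet.\<close>
    then have "xi (real n + r) = sum iota {1..n}"
      by (intro xi_eq_sum_iota) auto
    with eq below[of r] \<open>0 < r\<close> \<open>r < 1\<close> n have "iota n = 0"
      by simp
    then show False
      by (simp add: iota_def)
  qed
  ultimately show ?thesis
    using assms(2) by (simp add: oscillates_at_def)
qed

theorem theorem1p2:
  shows "infinite {y::real. \<exists>s::nat. 1 \<le> s \<and> 1 \<le> y - real s \<and> xi (y - real s) = xi (y + real s)}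
    \<and> infinite {y::real. \<exists>s::nat. 1 \<le> s \<and> oscillates_at y (real s)}"
    (is "infinite ?A \<and> infinite ?B")
proof -
  \<comment> \<open>The prime 2 is dropped because its point p - 1 = 1 lies below the bound 2 in
    \<open>oscillates_at\<close>.\<close>
  have "infinite ({p::nat. prime p} - {..2})"
    using primes_infinite by (intro Diff_infinite_finite) auto
  moreover have "inj_on (\<lambda>p. real (p - 1)) ({p::nat. prime p} - {..2})"
    by (auto simp: inj_on_def)
  moreover have "(\<lambda>p. real (p - 1)) ` ({p::nat. prime p} - {..2}) \<subseteq> ?B"
  proof (rule image_subsetI)
    fix p :: nat assume p: "p \<in> {p. prime p} - {..2}"
    then have "prime (Suc (p - 1))" "2 \<le> p - 1"
      by auto
    \<comment> \<open>The period is written \<open>real 1\<close> to match \<open>real s\<close> in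
      \<open>?B\<close> with witness s = 1.\<close>
    then have "oscillates_at (real (p - 1)) (real 1)"
      unfolding of_nat_1 by (rule oscillates_at_before_prime)
    then show "real (p - 1) \<in> ?B"
      by blast
  qed
  ultimately have "infinite ?B"
    by (meson finite_imageD finite_subset)
  \<comment> \<open>A period is an attained minimum, hence itself a balanced radius, so the same s
    works.\<close>
  moreover have "?B \<subseteq> ?A"
    by (auto simp: oscillates_at_def balanced_radii_def)
  ultimately show ?thesis
    using finite_subset by blast
qed

end
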